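(* Let $n$ be a natural number, let $E_j=E(\boldsymbol a_j,\boldsymbol b_j)$, $j=1,\ldots,N$, be ellipses in $\mathbb R^d$, let $P=\mathrm{co}\{E_1,\ldots,E_N\}$, and put $\alpha_m=2^{-m}\pi$. For $\boldsymbol w\in\mathbb R^d$, consider the linear programming problem in the variables $r^{(j)},x_s^{(j)}$ ($j=1,\ldots,N$, $s=1,\ldots,2n+2$): minimize $\sum_{j=1}^Nr^{(j)}$ subject to, for all $j=1,\ldots,N$ and $k=1,\ldots,n$, $$0\le x_2^{(j)}\le x_1^{(j)}\tan\alpha_{n-1},\qquad x_1^{(j)}+x_2^{(j)}\tan\alpha_n\le r^{(j)},\qquad r^{(j)}\ge0,$$ $$x_{2k+1}^{(j)}\cos\alpha_{n-k}+x_{2k+2}^{(j)}\sin\alpha_{n-k}=x_{2k-1}^{(j)}\cos\alpha_{n-k}+x_{2k}^{(j)}\sin\alpha_{n-k},$$ $$\big|-x_{2k+1}^{(j)}\sin\alpha_{n-k}+x_{2k+2}^{(j)}\cos\alpha_{n-k}\big|\le x_{2k-1}^{(j)}\sin\alpha_{n-k}-x_{2k}^{(j)}\cos\alpha_{n-k},$$ and $$\boldsymbol w=\sum_{j=1}^N\big(x_{2n+1}^{(j)}\boldsymbol a_j+x_{2n+2}^{(j)}\boldsymbol b_j\big).$$ If $r$ is the value of this problem, then for every $\boldsymbol w\in\mathbb R^d$ we have $$r\cos(2^{-n}\pi)\le\|\boldsymbol w\|_P\le r.$$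
   Context: For $\boldsymbol a,\boldsymbol b\in\mathbb R^d$, $E(\boldsymbol a,\boldsymbol b)=\{\boldsymbol a\cos t+\boldsymbol b\sin t : t\in\mathbb R\}$ is the (possibly degenerate) ellipse centred at the origin. $\mathrm{co}$ denotes the convex hull of the union of the listed sets. $\|\boldsymbol w\|_P$ is the minimal $\rho\ge0$ such that $\boldsymbol w\in\rho P$.
   Formalization: Proved for n ≥ 2 and N ≥ 1: for n = 0 the claim fails (w = −a_1), for n = 1 tan α_n is undefined; for n = 2, where tan α_{n−1} is undefined, the constraint 0 ≤ x_2 ≤ x_1 tan α_{n−1} is read as x_1, x_2 ≥ 0; both quantities are +∞ if w lies in no multiple of P. *)

theory Defs
  imports "HOL-Analysis.Analysis" "HOL-Library.Extended_Real"
begin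

definition ellipse :: "real ^ 'd \<Rightarrow> real ^ 'd \<Rightarrow> (real ^ 'd) set" where
  "ellipse a b = {cos t *\<^sub>R a + sin t *\<^sub>R b | t. t \<in> UNIV}"

definition co_ellipses ::
    "nat \<Rightarrow> (nat \<Rightarrow> real ^ 'd) \<Rightarrow> (nat \<Rightarrow> real ^ 'd) \<Rightarrow> (real ^ 'd) set" where
  "co_ellipses N a b = convex hull (\<Union>j\<in>{1..N}. ellipse (a j) (b j))"

(* The value is infinite when w lies in no multiple of P, which happens when P does
   not span the whole space. *)
definition norm_of :: "(real ^ 'd) set \<Rightarrow> real ^ 'd \<Rightarrow> ereal" where
  "norm_of P w =
     (if \<exists>\<rho>\<ge>0. w \<in> (\<lambda>p. \<rho> *\<^sub>R p) ` P
      then ereal (LEAST \<rho>. \<rho> \<ge> 0 \<and> w \<in> (\<lambda>p. \<rho> *\<^sub>R p) ` P)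
      else \<infinity>)"

definition \<alpha> :: "nat \<Rightarrow> real" where
  "\<alpha> m = pi / 2 ^ m"

(* The inequality y \<le> x tan \<theta>.  HOL sets tan (pi/2) = 0; at \<theta> = pi/2 the
   constraint 0 \<le> y \<le> x tan \<theta> is instead read as its limit for \<theta> tending to pi/2
   from below, the closed first quadrant.  This matters only for n = 2, since
   \<theta> = \<alpha> (n - 1) below. *)
definition le_mult_tan :: "real \<Rightarrow> real \<Rightarrow> real \<Rightarrow> bool" where
  "le_mult_tan y x \<theta> \<longleftrightarrow> (if \<theta> = pi / 2 then 0 \<le> x else y \<le> x * tan \<theta>)"

(* x j s is the variable with superscript j and subscript s; only the values
   r j and x j s with 1 \<le> j \<le> N and 1 \<le> s \<le> 2n+2 are constrained. *)
definition lp_feasible ::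
    "nat \<Rightarrow> nat \<Rightarrow> (nat \<Rightarrow> real ^ 'd) \<Rightarrow> (nat \<Rightarrow> real ^ 'd) \<Rightarrow> real ^ 'd
      \<Rightarrow> (nat \<Rightarrow> real) \<Rightarrow> (nat \<Rightarrow> nat \<Rightarrow> real) \<Rightarrow> bool" where
  "lp_feasible n N a b w r x \<longleftrightarrow>
     (\<forall>j\<in>{1..N}.
        0 \<le> x j 2 \<and> le_mult_tan (x j 2) (x j 1) (\<alpha> (n - 1)) \<and>
        x j 1 + x j 2 * tan (\<alpha> n) \<le> r j \<and> r j \<ge> 0 \<and>
        (\<forall>k\<in>{1..n}.
           x j (2*k+1) * cos (\<alpha> (n - k)) + x j (2*k+2) * sin (\<alpha> (n - k))
             = x j (2*k-1) * cos (\<alpha> (n - k)) + x j (2*k) * sin (\<alpha> (n - k)) \<and>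
           \<bar>- x j (2*k+1) * sin (\<alpha> (n - k)) + x j (2*k+2) * cos (\<alpha> (n - k))\<bar>
             \<le> x j (2*k-1) * sin (\<alpha> (n - k)) - x j (2*k) * cos (\<alpha> (n - k)))) \<and>
     w = (\<Sum>j=1..N. x j (2*n+1) *\<^sub>R a j + x j (2*n+2) *\<^sub>R b j)"

(* Infinite when the problem is infeasible. *)
definition lp_value ::
    "nat \<Rightarrow> nat \<Rightarrow> (nat \<Rightarrow> real ^ 'd) \<Rightarrow> (nat \<Rightarrow> real ^ 'd) \<Rightarrow> real ^ 'd \<Rightarrow> ereal" where
  "lp_value n N a b w =
     Inf {ereal (\<Sum>j=1..N. r j) | r x. lp_feasible n N a b w r x}"

end

(* Folding the plane n times along lines through the origin at angles pi, pi/2, ..., pi/2^(n-1)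
   maps it onto the sector of angle 2 pi/2^n.  The constraints on x_1, x_2 describe the isosceles
   triangle with legs r along the boundary of that sector, and the further constraints unfold it
   step by step, filling in segments between mirror images, to the regular 2^n-gon inscribed in the
   circle of radius r.  This polygon lies between the discs of radii r cos(pi/2^n) and r.  With discs
   in place of polygons the linear programme computes the norm of P exactly, since a point is in
   rho P iff it is a sum of points u_j a_j + v_j b_j with |(u_1, v_1)| + ... + |(u_N, v_N)| <= rho. *)
theory Submission
  imports Defs
begin

section \<open>Multiples of the hull of the ellipses in terms of coefficient pairs\<close>

text \<open>A coefficient pair (u_j, v_j) is encoded as a complex number, so that discs are
  described by \<open>cmod\<close> and polar coordinates are at hand.\<close>

definition ellipse_comb ::
    "nat \<Rightarrow> (nat \<Rightarrow> 'v::real_vector) \<Rightarrow> (nat \<Rightarrow> 'v) \<Rightarrow> (nat \<Rightarrow> complex) \<Rightarrow> 'v" where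
  "ellipse_comb N a b q = (\<Sum>j=1..N. Re (q j) *\<^sub>R a j + Im (q j) *\<^sub>R b j)"

lemma ellipse_comb_add:
  "ellipse_comb N a b (\<lambda>j. p j + q j) = ellipse_comb N a b p + ellipse_comb N a b q"
  by (simp add: ellipse_comb_def scaleR_left_distrib sum.distrib)

lemma ellipse_comb_scaleR:
  "ellipse_comb N a b (\<lambda>j. c *\<^sub>R q j) = c *\<^sub>R ellipse_comb N a b q"
  by (simp add: ellipse_comb_def scaleR_right.sum scaleR_right_distrib)

text \<open>Continuous image of the unit circle. Compactness is what makes the minimum defining the
  norm exist.\<close>

lemma compact_ellipse: "compact (ellipse a b)"
proof -
  have "ellipse a b = (\<lambda>z. Re z *\<^sub>R a + Im z *\<^sub>R b) ` sphere 0 1"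
  proof (intro equalityI subsetI)
    fix p assume "p \<in> ellipse a b"
    then obtain t where "p = cos t *\<^sub>R a + sin t *\<^sub>R b" by (auto simp: ellipse_def)
    then show "p \<in> (\<lambda>z. Re z *\<^sub>R a + Im z *\<^sub>R b) ` sphere 0 1"
      by (intro image_eqI[of _ _ "cis t"]) auto
  next
    fix p assume "p \<in> (\<lambda>z. Re z *\<^sub>R a + Im z *\<^sub>R b) ` sphere 0 1"
    then obtain z where z: "cmod z = 1" "p = Re z *\<^sub>R a + Im z *\<^sub>R b" by auto
    then obtain t where "z = cis t" by (metis complex_norm_eq_1_exp cis_conv_exp)
    with z show "p \<in> ellipse a b" by (auto simp: ellipse_def)
  qed
  moreover have "compact ((\<lambda>z. Re z *\<^sub>R a + Im z *\<^sub>R b) ` sphere 0 1)"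
    by (intro compact_continuous_image continuous_intros compact_sphere)
  ultimately show ?thesis by simp
qed

lemma compact_co_ellipses: "compact (co_ellipses N a b)"
  unfolding co_ellipses_def by (intro compact_convex_hull compact_UN compact_ellipse) auto

lemma ellipse_subset_co_ellipses:
  "j \<in> {1..N} \<Longrightarrow> ellipse (a j) (b j) \<subseteq> co_ellipses N a b"
  unfolding co_ellipses_def by (meson UN_upper hull_subset order_trans)

text \<open>An ellipse is symmetric about the origin: the parameters 0 and pi give opposite points,
  whose midpoint is 0.\<close>

lemma zero_in_co_ellipses:
  assumes "N \<ge> 1"
  shows "0 \<in> co_ellipses N a b"
proof -
  have *: "cos t *\<^sub>R a 1 + sin t *\<^sub>R b 1 \<in> co_ellipses N a b" for t
    using ellipse_subset_co_ellipses[of 1 N a b] assms by (auto simp: ellipse_def)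
  have "a 1 \<in> co_ellipses N a b" "- a 1 \<in> co_ellipses N a b"
    using *[of 0] *[of pi] by simp_all
  then have "(1/2) *\<^sub>R a 1 + (1/2) *\<^sub>R (- a 1) \<in> co_ellipses N a b"
    unfolding co_ellipses_def by (intro convexD[OF convex_convex_hull]) auto
  then show ?thesis by simp
qed

text \<open>By the triangle inequality the combinations with total modulus at most 1 form a convex
  set; it contains every ellipse, hence their hull.\<close>

lemma co_ellipses_imp_ellipse_comb:
  assumes "p \<in> co_ellipses N a b"
  shows "\<exists>q. p = ellipse_comb N a b q \<and> (\<Sum>j=1..N. cmod (q j)) \<le> 1"
proof -
  define D where "D = {ellipse_comb N a b q | q. (\<Sum>j=1..N. cmod (q j)) \<le> 1}"
  have "convex D"
  proof (rule convexI)
    fix x y and s t :: real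
    assume st: "s \<ge> 0" "t \<ge> 0" "s + t = 1" and "x \<in> D" "y \<in> D"
    then obtain p q where p: "x = ellipse_comb N a b p" "(\<Sum>j=1..N. cmod (p j)) \<le> 1"
      and q: "y = ellipse_comb N a b q" "(\<Sum>j=1..N. cmod (q j)) \<le> 1"
      by (auto simp: D_def)
    have "(\<Sum>j=1..N. cmod (s *\<^sub>R p j + t *\<^sub>R q j))
        \<le> (\<Sum>j=1..N. s * cmod (p j) + t * cmod (q j))"
      using st by (intro sum_mono) (metis abs_of_nonneg norm_scaleR norm_triangle_ineq)
    also have "\<dots> = s * (\<Sum>j=1..N. cmod (p j)) + t * (\<Sum>j=1..N. cmod (q j))"
      by (simp add: sum.distrib sum_distrib_left)
    also have "\<dots> \<le> 1"
      using p q st by (simp add: convex_bound_le)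
    finally have "ellipse_comb N a b (\<lambda>j. s *\<^sub>R p j + t *\<^sub>R q j) \<in> D"
      by (auto simp: D_def)
    then show "s *\<^sub>R x + t *\<^sub>R y \<in> D"
      by (simp only: ellipse_comb_add ellipse_comb_scaleR p q)
  qed
  moreover have "(\<Union>j\<in>{1..N}. ellipse (a j) (b j)) \<subseteq> D"
  proof safe
    fix j x assume j: "j \<in> {1..N}" and "x \<in> ellipse (a j) (b j)"
    then obtain t where t: "x = cos t *\<^sub>R a j + sin t *\<^sub>R b j" by (auto simp: ellipse_def)
    let ?q = "\<lambda>i. if i = j then cis t else 0"
    have "ellipse_comb N a b ?q
        = (\<Sum>i=1..N. if i = j then cos t *\<^sub>R a i + sin t *\<^sub>R b i else 0)"
      unfolding ellipse_comb_def by (intro sum.cong) auto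
    then have "x = ellipse_comb N a b ?q" using j t by simp
    moreover have "(\<Sum>i=1..N. cmod (?q i)) = (\<Sum>i=1..N. if i = j then 1 else 0)"
      by (intro sum.cong) auto
    then have "(\<Sum>i=1..N. cmod (?q i)) \<le> 1" using j by simp
    ultimately show "x \<in> D" by (auto simp: D_def)
  qed
  ultimately have "co_ellipses N a b \<subseteq> D"
    unfolding co_ellipses_def by (intro hull_minimal)
  with assms show ?thesis by (auto simp: D_def)
qed

text \<open>In polar form each term is \<open>cmod (q j)\<close> times a point of the j-th ellipse.
  Dividing by the total modulus gives a convex combination of such points.\<close>

lemma ellipse_comb_in_scaled_co_ellipses:
  assumes "N \<ge> 1" and le: "(\<Sum>j=1..N. cmod (q j)) \<le> \<rho>"
  shows "ellipse_comb N a b q \<in> (\<lambda>p. \<rho> *\<^sub>R p) ` co_ellipses N a b"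
proof -
  let ?P = "co_ellipses N a b"
  define \<sigma> where "\<sigma> = (\<Sum>j=1..N. cmod (q j))"
  define e where "e j = cos (Arg (q j)) *\<^sub>R a j + sin (Arg (q j)) *\<^sub>R b j" for j
  have "convex ?P" by (simp add: co_ellipses_def)
  have e: "e j \<in> ?P" if "j \<in> {1..N}" for j
    using ellipse_subset_co_ellipses[OF that, of a b] by (auto simp: e_def ellipse_def)
  have "Re (q j) = cmod (q j) * cos (Arg (q j))" "Im (q j) = cmod (q j) * sin (Arg (q j))" for j
    by (metis Re_rcis rcis_cmod_Arg, metis Im_rcis rcis_cmod_Arg)
  then have comb: "ellipse_comb N a b q = (\<Sum>j=1..N. cmod (q j) *\<^sub>R e j)"
    by (simp add: ellipse_comb_def e_def scaleR_right_distrib)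
  have "\<sigma> \<ge> 0" by (simp add: \<sigma>_def sum_nonneg)
  show ?thesis
  proof (cases "\<sigma> = 0")
    case True
    then have "\<forall>j\<in>{1..N}. cmod (q j) = 0"
      unfolding \<sigma>_def by (subst (asm) sum_nonneg_eq_0_iff) auto
    then have "ellipse_comb N a b q = 0"
      unfolding comb by simp
    then show ?thesis
      using zero_in_co_ellipses[OF assms(1)] by (intro image_eqI[of _ _ 0]) auto
  next
    case False
    with \<open>\<sigma> \<ge> 0\<close> le have pos: "\<sigma> > 0" "\<rho> > 0" "\<sigma> \<le> \<rho>" by (auto simp: \<sigma>_def)
    have "(\<Sum>j=1..N. (cmod (q j) / \<sigma>) *\<^sub>R e j) \<in> ?P"
      using pos e by (intro convex_sum \<open>convex ?P\<close>)
        (auto simp: \<sigma>_def sum_divide_distrib[symmetric])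
    \<comment> \<open>The spare weight goes to the origin, which turns the factor \<sigma> into
      \<rho>.\<close>
    then have "(\<sigma> / \<rho>) *\<^sub>R (\<Sum>j=1..N. (cmod (q j) / \<sigma>) *\<^sub>R e j) + (1 - \<sigma> / \<rho>) *\<^sub>R 0 \<in> ?P"
      using pos by (intro convexD[OF \<open>convex ?P\<close>] zero_in_co_ellipses assms(1)) auto
    moreover have "\<rho> *\<^sub>R ((\<sigma> / \<rho>) *\<^sub>R (\<Sum>j=1..N. (cmod (q j) / \<sigma>) *\<^sub>R e j) + (1 - \<sigma> / \<rho>) *\<^sub>R 0)
        = ellipse_comb N a b q"
      using pos by (simp add: comb scaleR_right.sum)
    ultimately show ?thesis by (intro image_eqI[OF sym])
  qed
qed

section \<open>The norm as an attained minimum\<close>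

text \<open>\<open>LEAST\<close> on the reals is informative only if the minimum is attained.
  Compactness of \<open>P\<close> ensures this, so later arguments can avoid
  \<open>LEAST\<close>.\<close>

lemma norm_of_cases:
  assumes "compact P"
  obtains "norm_of P w = \<infinity>" and "\<And>\<rho>. \<rho> \<ge> 0 \<Longrightarrow> w \<notin> (\<lambda>p. \<rho> *\<^sub>R p) ` P"
  | \<rho> where "norm_of P w = ereal \<rho>" and "\<rho> \<ge> 0" and "w \<in> (\<lambda>p. \<rho> *\<^sub>R p) ` P"
      and "\<And>\<rho>'. \<rho>' \<ge> 0 \<Longrightarrow> w \<in> (\<lambda>p. \<rho>' *\<^sub>R p) ` P \<Longrightarrow> \<rho> \<le> \<rho>'"
proof (cases "\<exists>\<rho>\<ge>0. w \<in> (\<lambda>p. \<rho> *\<^sub>R p) ` P")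
  case False
  then show ?thesis by (intro that(1)) (auto simp: norm_of_def)
next
  case True
  then obtain M where M: "M \<ge> 0" "w \<in> (\<lambda>p. M *\<^sub>R p) ` P" by auto
  \<comment> \<open>Cutting off at one admissible factor \<open>M\<close> makes the set of pairs
    (factor, point) compact; its projection has a least element.\<close>
  let ?K = "({0..M} \<times> P) \<inter> {z. fst z *\<^sub>R snd z = w}"
  have "compact ?K"
    by (intro compact_Int_closed compact_Times assms closed_Collect_eq continuous_intros) auto
  then have "compact (fst ` ?K)"
    by (intro compact_continuous_image continuous_intros)
  moreover have "M \<in> fst ` ?K" using M by force
  ultimately obtain \<rho> where \<rho>: "\<rho> \<in> fst ` ?K" "\<And>\<rho>'. \<rho>' \<in> fst ` ?K \<Longrightarrow> \<rho> \<le> \<rho>'"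
    using compact_attains_inf[of "fst ` ?K"] by blast
  then have in\<rho>: "\<rho> \<ge> 0" "\<rho> \<le> M" "w \<in> (\<lambda>p. \<rho> *\<^sub>R p) ` P" by auto
  have least: "\<rho> \<le> \<rho>'" if "\<rho>' \<ge> 0" "w \<in> (\<lambda>p. \<rho>' *\<^sub>R p) ` P" for \<rho>'
  proof (cases "\<rho>' \<le> M")
    case True
    then have "\<rho>' \<in> fst ` ?K" using that by force
    then show ?thesis by (rule \<rho>(2))
  qed (use in\<rho> in linarith)
  have "(LEAST \<rho>. \<rho> \<ge> 0 \<and> w \<in> (\<lambda>p. \<rho> *\<^sub>R p) ` P) = \<rho>"
    using in\<rho> least by (intro Least_equality) auto
  then show ?thesis
    using True in\<rho> least by (intro that(2)[of \<rho>]) (auto simp: norm_of_def)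
qed

section \<open>A single unfolding step\<close>

(* z' lies on the segment between z and its mirror image in the line of direction cis \<theta>,
   and z is on the clockwise side of that line. *)
definition unfolds_to :: "real \<Rightarrow> complex \<Rightarrow> complex \<Rightarrow> bool" where
  "unfolds_to \<theta> z z' \<longleftrightarrow>
     Re z' * cos \<theta> + Im z' * sin \<theta> = Re z * cos \<theta> + Im z * sin \<theta> \<and>
     \<bar>- Re z' * sin \<theta> + Im z' * cos \<theta>\<bar> \<le> Re z * sin \<theta> - Im z * cos \<theta>"

text \<open>In coordinates along and across the line, the first is preserved and the second does not
  grow in absolute value.\<close>

lemma unfolds_to_norm_le:
  assumes "unfolds_to \<theta> z z'"
  shows "cmod z' \<le> cmod z"
proof -
  have rot: "(cmod z)\<^sup>2 = (Re z * cos \<theta> + Im z * sin \<theta>)\<^sup>2 + (Re z * sin \<theta> - Im z * cos \<theta>)\<^sup>2" for z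
  proof -
    have "(Re z * cos \<theta> + Im z * sin \<theta>)\<^sup>2 + (Re z * sin \<theta> - Im z * cos \<theta>)\<^sup>2
        = ((Re z)\<^sup>2 + (Im z)\<^sup>2) * ((sin \<theta>)\<^sup>2 + (cos \<theta>)\<^sup>2)" by algebra
    then show ?thesis by (simp add: cmod_power2)
  qed
  have "\<bar>Re z' * sin \<theta> - Im z' * cos \<theta>\<bar> \<le> \<bar>Re z * sin \<theta> - Im z * cos \<theta>\<bar>"
    using assms by (auto simp: unfolds_to_def)
  then have "(cmod z')\<^sup>2 \<le> (cmod z)\<^sup>2"
    using assms unfolding rot by (simp add: unfolds_to_def abs_le_square_iff)
  then show ?thesis by simp
qed

text \<open>The angle \<open>\<theta> - \<bar>\<phi> - \<theta>\<bar>\<close> is \<phi> or its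
  mirror image, whichever lies clockwise of the line. It differs from \<theta> by at most pi, so the
  sine is nonnegative and the absolute value constraint holds with equality.\<close>

lemma unfolds_to_rcis:
  assumes "\<rho> \<ge> 0" "\<theta> \<le> pi" "0 \<le> \<phi>" "\<phi> \<le> 2 * \<theta>"
  shows "unfolds_to \<theta> (rcis \<rho> (\<theta> - \<bar>\<phi> - \<theta>\<bar>)) (rcis \<rho> \<phi>)"
proof -
  define \<psi> where "\<psi> = \<theta> - \<bar>\<phi> - \<theta>\<bar>"
  have comp: "Re (rcis \<rho> t) * cos \<theta> + Im (rcis \<rho> t) * sin \<theta> = \<rho> * cos (t - \<theta>)"
    "Re (rcis \<rho> t) * sin \<theta> - Im (rcis \<rho> t) * cos \<theta> = \<rho> * sin (\<theta> - t)" for t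
    by (simp_all add: cos_diff sin_diff algebra_simps)
  have "cos (\<psi> - \<theta>) = cos (\<phi> - \<theta>)" by (simp add: \<psi>_def)
  moreover have "sin (\<theta> - \<psi>) = \<bar>sin (\<theta> - \<phi>)\<bar>"
  proof (cases "\<phi> \<le> \<theta>")
    case True
    with assms show ?thesis by (simp add: \<psi>_def sin_ge_zero)
  next
    case False
    moreover have "sin (\<phi> - \<theta>) \<ge> 0" using False assms by (intro sin_ge_zero) auto
    moreover have "sin (\<theta> - \<phi>) = - sin (\<phi> - \<theta>)" by (metis minus_diff_eq sin_minus)
    ultimately show ?thesis by (simp add: \<psi>_def)
  qed
  moreover have "\<bar>- Re z * sin \<theta> + Im z * cos \<theta>\<bar> = \<bar>Re z * sin \<theta> - Im z * cos \<theta>\<bar>" for z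
    by linarith
  ultimately show ?thesis
    using assms(1) unfolding unfolds_to_def \<psi>_def[symmetric]
    by (simp only: comp abs_mult) simp
qed

section \<open>Folding a given point into the initial sector\<close>

text \<open>Folds at pi, pi/2, pi/4 and so on. The linear programme passes through these angles in
  reverse order.\<close>

primrec folded_angle :: "real \<Rightarrow> nat \<Rightarrow> real" where
  "folded_angle \<phi> 0 = \<phi>"
| "folded_angle \<phi> (Suc m) = \<alpha> m - \<bar>folded_angle \<phi> m - \<alpha> m\<bar>"

lemma \<alpha>_Suc: "\<alpha> m = 2 * \<alpha> (Suc m)"
  by (simp add: \<alpha>_def)

lemma \<alpha>_bounds: "0 < \<alpha> m" "\<alpha> m \<le> pi"
proof -
  show "0 < \<alpha> m" by (simp add: \<alpha>_def)
  have "(1::real) \<le> 2 ^ m" by simp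
  then show "\<alpha> m \<le> pi" by (simp add: \<alpha>_def field_simps)
qed

lemma \<alpha>_lt_pi_half:
  assumes "m \<ge> 2"
  shows "\<alpha> m < pi / 2"
proof -
  obtain k where "m = Suc (Suc k)" using assms by (metis add_2_eq_Suc le_Suc_ex)
  then show ?thesis using \<alpha>_bounds(2)[of k] \<alpha>_bounds(1)[of m] \<alpha>_Suc[of k] \<alpha>_Suc[of "Suc k"] by simp
qed

text \<open>A fold at the bisector halves the sector: [0, 2 \<open>\<alpha> m\<close>] goes to
  [0, \<open>\<alpha> m\<close>], which is the next sector since
  \<open>\<alpha> m = 2 * \<alpha> (Suc m)\<close>.\<close>

lemma folded_angle_bounds:
  assumes "0 \<le> \<phi>" "\<phi> \<le> 2 * pi"
  shows "0 \<le> folded_angle \<phi> m \<and> folded_angle \<phi> m \<le> 2 * \<alpha> m"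
proof (induction m)
  case 0
  with assms show ?case by (simp add: \<alpha>_def)
next
  case (Suc m)
  then have "0 \<le> \<alpha> m - \<bar>folded_angle \<phi> m - \<alpha> m\<bar>" "\<alpha> m - \<bar>folded_angle \<phi> m - \<alpha> m\<bar> \<le> \<alpha> m"
    by linarith+
  then show ?case using \<alpha>_Suc[of m] by simp
qed

text \<open>The folding of \<open>z\<close> read backwards: all points keep the modulus of
  \<open>z\<close>, and the k-th one has the angle left after \<open>n - k\<close> folds.\<close>

lemma exists_unfolding_chain:
  obtains p \<psi> where "p n = z" "p 0 = rcis (cmod z) \<psi>" "0 \<le> \<psi>" "\<psi> \<le> 2 * \<alpha> n"
    "\<And>k. k < n \<Longrightarrow> unfolds_to (\<alpha> (n - Suc k)) (p k) (p (Suc k))"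
proof -
  define \<phi> where "\<phi> = Arg2pi z"
  have \<phi>: "0 \<le> \<phi>" "\<phi> \<le> 2 * pi"
    using Arg2pi_ge_0[of z] Arg2pi_lt_2pi[of z] unfolding \<phi>_def by linarith+
  have z: "rcis (cmod z) \<phi> = z"
    using Arg2pi_eq[of z] by (simp add: \<phi>_def rcis_def cis_conv_exp)
  note bounds = folded_angle_bounds[OF \<phi>]
  have "unfolds_to (\<alpha> (n - Suc k)) (rcis (cmod z) (folded_angle \<phi> (n - k)))
      (rcis (cmod z) (folded_angle \<phi> (n - Suc k)))" if "k < n" for k
  proof -
    have "n - k = Suc (n - Suc k)" using that by simp
    then show ?thesis
      using unfolds_to_rcis[of "cmod z" "\<alpha> (n - Suc k)" "folded_angle \<phi> (n - Suc k)"]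
        bounds[of "n - Suc k"] \<alpha>_bounds(2) by simp
  qed
  then show ?thesis
    using bounds[of n] z
    by (intro that[of "\<lambda>k. rcis (cmod z) (folded_angle \<phi> (n - k))" "folded_angle \<phi> n"]) auto
qed

lemma tan_cos_\<alpha>_pos:
  assumes "n \<ge> 2"
  shows "0 < tan (\<alpha> n)" "0 < cos (\<alpha> n)"
  using \<alpha>_bounds(1)[of n] \<alpha>_lt_pi_half[OF assms] by (auto intro: tan_gt_zero cos_gt_zero)

section \<open>The initial triangle and feasible solutions\<close>

text \<open>With t = tan (\<open>\<alpha> n\<close>), the difference of
  \<open>(x + y * t)\<^sup>2\<close> and \<open>x\<^sup>2 + y\<^sup>2\<close> is
  \<open>y * (2 * x * t - y * (1 - t\<^sup>2))\<close>. By the double angle formula its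
  nonnegativity is the sector constraint.\<close>

lemma initial_triangle_norm_le:
  assumes n: "n \<ge> 2" and y: "0 \<le> y" "le_mult_tan y x (\<alpha> (n - 1))"
    and r: "x + y * tan (\<alpha> n) \<le> r"
  shows "cmod (Complex x y) \<le> r"
proof -
  define t where "t = tan (\<alpha> n)"
  have t: "0 < t" using tan_cos_\<alpha>_pos[OF n] by (simp add: t_def)
  have dbl: "\<alpha> (n - 1) = 2 * \<alpha> n" using \<alpha>_Suc[of "n - 1"] n by simp
  \<comment> \<open>Clearing the denominator of tan (2 \<open>\<alpha> n\<close>) also covers the
    right angle, where t = 1 and only the sign of \<open>x\<close> matters.\<close>
  have "x \<ge> 0 \<and> y * (1 - t\<^sup>2) \<le> 2 * x * t"
  proof (cases "\<alpha> (n - 1) = pi / 2")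
    case True
    then have "\<alpha> n = pi / 4" using dbl by simp
    then have "t = 1" unfolding t_def using tan_45 by metis
    with True y show ?thesis by (simp add: le_mult_tan_def)
  next
    case False
    have "n \<noteq> 2" using False by (auto simp: \<alpha>_def)
    then have lt: "\<alpha> (n - 1) < pi / 2" using n by (intro \<alpha>_lt_pi_half) auto
    have "0 < tan (\<alpha> (n - 1))" using lt \<alpha>_bounds(1) by (intro tan_gt_zero)
    moreover have le: "y \<le> x * tan (\<alpha> (n - 1))" using y False by (simp add: le_mult_tan_def)
    ultimately have "x \<ge> 0" using y(1)
      by (smt (verit) mult_neg_pos)
    have "tan (\<alpha> n) < tan (pi / 4)"
      using lt dbl \<alpha>_bounds(1)[of n] by (intro tan_monotone) auto
    then have "t < 1" by (simp add: t_def tan_45)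
    then have t2: "1 - t\<^sup>2 > 0" using t by (simp add: power_less_one_iff abs_square_less_1)
    have "tan (\<alpha> (n - 1)) = 2 * t / (1 - t\<^sup>2)"
      using tan_cos_\<alpha>_pos[OF n] lt dbl \<alpha>_bounds(1)[of "n - 1"] cos_gt_zero[of "\<alpha> (n - 1)"]
      by (simp add: t_def tan_double)
    then have "tan (\<alpha> (n - 1)) * (1 - t\<^sup>2) = 2 * t" using t2 by simp
    moreover have "y * (1 - t\<^sup>2) \<le> x * tan (\<alpha> (n - 1)) * (1 - t\<^sup>2)"
      using le t2 by (intro mult_right_mono) auto
    ultimately have "y * (1 - t\<^sup>2) \<le> 2 * x * t" by (simp add: mult.assoc)
    with \<open>x \<ge> 0\<close> show ?thesis ..
  qed
  then have x: "x \<ge> 0" and "y * (y * (1 - t\<^sup>2)) \<le> y * (2 * x * t)"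
    using y(1) by (auto intro: mult_left_mono)
  then have "x\<^sup>2 + y\<^sup>2 \<le> (x + y * t)\<^sup>2"
    by (simp add: power2_eq_square algebra_simps)
  moreover have "0 \<le> x + y * t" using x y t by simp
  ultimately have "cmod (Complex x y) \<le> x + y * t"
    by (simp add: cmod_def real_le_lsqrt)
  with r show ?thesis by (simp add: t_def)
qed

text \<open>Consecutive variables become points of the plane, one per unfolding stage. Relating
  \<open>p\<close> and \<open>x\<close> by an equation allows either to be defined from the
  other.\<close>

lemma lp_feasible_iff:
  assumes "\<And>j k. j \<in> {1..N} \<Longrightarrow> p j k = Complex (x j (2 * k + 1)) (x j (2 * k + 2))"
  shows "lp_feasible n N a b w r x \<longleftrightarrow>
     (\<forall>j\<in>{1..N}. 0 \<le> Im (p j 0) \<and> le_mult_tan (Im (p j 0)) (Re (p j 0)) (\<alpha> (n - 1)) \<and>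
        Re (p j 0) + Im (p j 0) * tan (\<alpha> n) \<le> r j \<and> r j \<ge> 0 \<and>
        (\<forall>k<n. unfolds_to (\<alpha> (n - Suc k)) (p j k) (p j (Suc k)))) \<and>
     w = ellipse_comb N a b (\<lambda>j. p j n)"
proof -
  \<comment> \<open>Constraint k leads from stage k - 1 to stage k, whereas the stages are counted
    from 0.\<close>
  have shift: "(\<forall>k\<in>{1..n}. Q k) \<longleftrightarrow> (\<forall>k<n. Q (Suc k))" for Q
    by (metis Suc_le_D Suc_le_eq atLeastAtMost_iff One_nat_def Suc_le_mono zero_le)
  have "ellipse_comb N a b (\<lambda>j. p j n)
      = (\<Sum>j=1..N. x j (2*n+1) *\<^sub>R a j + x j (2*n+2) *\<^sub>R b j)"
    unfolding ellipse_comb_def by (intro sum.cong) (auto simp: assms)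
  then show ?thesis
    unfolding lp_feasible_def shift unfolds_to_def
    by (intro arg_cong2[where f = "(\<and>)"] ball_cong) (simp_all add: assms numeral_2_eq_2)
qed

text \<open>The triangle lies in the disc of radius \<open>r j\<close> and unfolding never increases
  the modulus, so the final points stay in these discs.\<close>

lemma lp_feasible_imp_in_scaled:
  assumes "n \<ge> 2" "N \<ge> 1" "lp_feasible n N a b w r x"
  shows "w \<in> (\<lambda>p. (\<Sum>j=1..N. r j) *\<^sub>R p) ` co_ellipses N a b"
proof -
  define p where "p j k = Complex (x j (2 * k + 1)) (x j (2 * k + 2))" for j k
  note feas = assms(3)[unfolded lp_feasible_iff[of N p x, OF p_def]]
  have "cmod (p j n) \<le> r j" if j: "j \<in> {1..N}" for j
  proof -
    have "cmod (p j k) \<le> r j" if "k \<le> n" for k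
      using that
    proof (induction k)
      case 0
      show ?case
        using initial_triangle_norm_le[OF assms(1), of "Im (p j 0)" "Re (p j 0)"] feas j by simp
    next
      case (Suc k)
      then have "unfolds_to (\<alpha> (n - Suc k)) (p j k) (p j (Suc k))" using feas j by simp
      then show ?case using Suc unfolds_to_norm_le by fastforce
    qed
    then show ?thesis by simp
  qed
  then have "(\<Sum>j=1..N. cmod (p j n)) \<le> (\<Sum>j=1..N. r j)" by (rule sum_mono)
  then show ?thesis
    using ellipse_comb_in_scaled_co_ellipses[OF assms(2), of "\<lambda>j. p j n"] feas by simp
qed

text \<open>The side opposite the origin has its normal at angle \<open>\<alpha> n\<close>, and the
  third quantity is \<open>\<rho> * cos (\<psi> - \<alpha> n) / cos (\<alpha> n)\<close>. This is
  the source of the factor lost in the approximation.\<close>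

lemma rcis_in_initial_triangle:
  assumes n: "n \<ge> 2" and "\<rho> \<ge> 0" and \<psi>: "0 \<le> \<psi>" "\<psi> \<le> 2 * \<alpha> n"
  shows "0 \<le> Im (rcis \<rho> \<psi>)"
    and "le_mult_tan (Im (rcis \<rho> \<psi>)) (Re (rcis \<rho> \<psi>)) (\<alpha> (n - 1))"
    and "Re (rcis \<rho> \<psi>) + Im (rcis \<rho> \<psi>) * tan (\<alpha> n) \<le> \<rho> / cos (\<alpha> n)"
proof -
  have dbl: "\<alpha> (n - 1) = 2 * \<alpha> n" using \<alpha>_Suc[of "n - 1"] n by simp
  have le: "2 * \<alpha> n \<le> pi" using \<alpha>_bounds(2)[of "n - 1"] dbl by simp
  then show "0 \<le> Im (rcis \<rho> \<psi>)"
    using assms by (auto intro!: mult_nonneg_nonneg sin_ge_zero)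
  show "le_mult_tan (Im (rcis \<rho> \<psi>)) (Re (rcis \<rho> \<psi>)) (\<alpha> (n - 1))"
  proof (cases "\<alpha> (n - 1) = pi / 2")
    case True
    then show ?thesis
      using assms dbl by (auto simp: le_mult_tan_def intro!: mult_nonneg_nonneg cos_ge_zero)
  next
    case False
    have "n \<noteq> 2" using False by (auto simp: \<alpha>_def)
    then have lt: "\<alpha> (n - 1) < pi / 2" using n by (intro \<alpha>_lt_pi_half) auto
    then have c: "cos (\<alpha> (n - 1)) > 0" using \<alpha>_bounds(1) by (intro cos_gt_zero)
    \<comment> \<open>Divided by the positive cosine of \<open>\<alpha> (n - 1)\<close>, this is the
      tangent constraint.\<close>
    have "sin (\<alpha> (n - 1) - \<psi>) \<ge> 0"
      using \<psi> dbl le by (intro sin_ge_zero) auto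
    then have "sin \<psi> * cos (\<alpha> (n - 1)) \<le> cos \<psi> * sin (\<alpha> (n - 1))"
      by (simp add: sin_diff algebra_simps)
    then have "sin \<psi> \<le> cos \<psi> * tan (\<alpha> (n - 1))"
      using c by (simp add: tan_def field_simps)
    then have "\<rho> * sin \<psi> \<le> \<rho> * (cos \<psi> * tan (\<alpha> (n - 1)))"
      using \<open>\<rho> \<ge> 0\<close> by (rule mult_left_mono)
    with False show ?thesis by (simp add: le_mult_tan_def mult.assoc)
  qed
  have c: "cos (\<alpha> n) > 0" using tan_cos_\<alpha>_pos[OF n] by simp
  then have "Re (rcis \<rho> \<psi>) + Im (rcis \<rho> \<psi>) * tan (\<alpha> n) = \<rho> * cos (\<psi> - \<alpha> n) / cos (\<alpha> n)"
    by (simp add: tan_def cos_diff field_simps)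
  also have "\<dots> \<le> \<rho> / cos (\<alpha> n)"
    using c \<open>\<rho> \<ge> 0\<close> by (intro divide_right_mono mult_left_le) auto
  finally show "Re (rcis \<rho> \<psi>) + Im (rcis \<rho> \<psi>) * tan (\<alpha> n) \<le> \<rho> / cos (\<alpha> n)" .
qed

text \<open>Each \<open>q j\<close> is folded into the initial sector; enlarging the radius by
  \<open>1 / cos (\<alpha> n)\<close> puts the folded point into the triangle.\<close>

lemma lp_feasible_ellipse_comb:
  assumes "n \<ge> 2"
  shows "\<exists>x. lp_feasible n N a b (ellipse_comb N a b q) (\<lambda>j. cmod (q j) / cos (\<alpha> n)) x"
proof -
  have "\<exists>p \<psi>. p n = q j \<and> p 0 = rcis (cmod (q j)) \<psi> \<and> 0 \<le> \<psi> \<and> \<psi> \<le> 2 * \<alpha> n \<and>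
      (\<forall>k<n. unfolds_to (\<alpha> (n - Suc k)) (p k) (p (Suc k)))" for j
    using exists_unfolding_chain[of n "q j"] by metis
  then obtain p \<psi> where p: "\<And>j. p j n = q j" "\<And>j. p j 0 = rcis (cmod (q j)) (\<psi> j)"
      "\<And>j. 0 \<le> \<psi> j" "\<And>j. \<psi> j \<le> 2 * \<alpha> n"
      "\<And>j k. k < n \<Longrightarrow> unfolds_to (\<alpha> (n - Suc k)) (p j k) (p j (Suc k))"
    by metis
  \<comment> \<open>Stage k occupies the subscripts 2k+1 (real part) and 2k+2 (imaginary
    part).\<close>
  define x where "x j s = (if odd s then Re (p j (s div 2)) else Im (p j (s div 2 - 1)))"
    for j s :: nat
  have px: "p j k = Complex (x j (2 * k + 1)) (x j (2 * k + 2))" for j k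
    by (simp add: x_def)
  note triangle = rcis_in_initial_triangle[OF assms norm_ge_zero p(3,4), of "q j" j for j,
    folded p(2)]
  have "cmod (q j) / cos (\<alpha> n) \<ge> 0" for j
    using tan_cos_\<alpha>_pos(2)[OF assms] by simp
  then have "lp_feasible n N a b (ellipse_comb N a b q) (\<lambda>j. cmod (q j) / cos (\<alpha> n)) x"
    unfolding lp_feasible_iff[of N p x, OF px] p(1) using triangle p(5) by blast
  then show ?thesis by blast
qed

section \<open>Comparison of the value with the norm\<close>

theorem theorem8p1:
  fixes n N :: nat and a b :: "nat \<Rightarrow> real ^ 'd" and w :: "real ^ 'd"
    and P :: "(real ^ 'd) set" and r :: ereal
  assumes "n \<ge> 2" and "N \<ge> 1"
    and "P = co_ellipses N a b"
    and "r = lp_value n N a b w"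
  shows "r * ereal (cos (pi / 2 ^ n)) \<le> norm_of P w \<and> norm_of P w \<le> r"
proof -
  have c: "cos (\<alpha> n) > 0" using tan_cos_\<alpha>_pos(2)[OF assms(1)] .
  have "compact P" using assms(3) compact_co_ellipses by simp
  have upper: "w \<in> (\<lambda>p. (\<Sum>j=1..N. s j) *\<^sub>R p) ` P" "0 \<le> (\<Sum>j=1..N. s j)"
    if "lp_feasible n N a b w s x" for s x
    using lp_feasible_imp_in_scaled[OF assms(1,2) that] that assms(3)
    by (auto simp: lp_feasible_def intro!: sum_nonneg)
  from \<open>compact P\<close> show ?thesis
  proof (cases rule: norm_of_cases[of P w])
    case 1
    \<comment> \<open>The objective of a feasible solution would be an admissible factor, so the
      infimum is over the empty set.\<close>
    then have "\<not> lp_feasible n N a b w s x" for s x using upper by blast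
    then have "r = \<infinity>" by (simp add: assms(4) lp_value_def top_ereal_def)
    then show ?thesis by (simp add: 1)
  next
    case (2 \<rho>)
    have "norm_of P w \<le> r"
      unfolding assms(4) lp_value_def
    proof (rule Inf_greatest, safe)
      fix s x assume "lp_feasible n N a b w s x"
      then show "norm_of P w \<le> ereal (\<Sum>j=1..N. s j)"
        using 2(1) 2(4) upper by simp
    qed
    moreover have "r * ereal (cos (\<alpha> n)) \<le> norm_of P w"
    proof -
      \<comment> \<open>The minimal factor is attained, so scaling the coefficients of
        \<open>p\<close> by \<rho> yields a feasible solution with objective at most
        \<open>\<rho> / cos (\<alpha> n)\<close>.\<close>
      obtain p where p: "p \<in> P" "w = \<rho> *\<^sub>R p" using 2(3) by auto
      then obtain q where q: "p = ellipse_comb N a b q" "(\<Sum>j=1..N. cmod (q j)) \<le> 1"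
        using co_ellipses_imp_ellipse_comb assms(3) by blast
      have w: "w = ellipse_comb N a b (\<lambda>j. \<rho> *\<^sub>R q j)"
        by (simp add: p q ellipse_comb_scaleR)
      obtain x where "lp_feasible n N a b w (\<lambda>j. cmod (\<rho> *\<^sub>R q j) / cos (\<alpha> n)) x"
        using lp_feasible_ellipse_comb[OF assms(1)] unfolding w by blast
      then have "r \<le> ereal (\<Sum>j=1..N. cmod (\<rho> *\<^sub>R q j) / cos (\<alpha> n))"
        unfolding assms(4) lp_value_def by (intro Inf_lower) blast
      also have "(\<Sum>j=1..N. cmod (\<rho> *\<^sub>R q j) / cos (\<alpha> n))
          = \<rho> * (\<Sum>j=1..N. cmod (q j)) / cos (\<alpha> n)"
        using 2(2) by (simp add: sum_divide_distrib sum_distrib_left)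
      also have "\<dots> \<le> \<rho> / cos (\<alpha> n)"
        using c q(2) 2(2) by (intro divide_right_mono mult_left_le) auto
      finally have "r * ereal (cos (\<alpha> n)) \<le> ereal (\<rho> / cos (\<alpha> n)) * ereal (cos (\<alpha> n))"
        using c by (intro ereal_mult_right_mono) auto
      also have "\<dots> = norm_of P w" using c 2(1) by simp
      finally show ?thesis .
    qed
    ultimately show ?thesis by (simp add: \<alpha>_def)
  qed
qed

end
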